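(* Let $n$ be a positive integer, let $\lambda$ be a partition of $n$ with exactly $k$ parts of size $1$, and let $\mathfrak{S}_n(\lambda)$ be the set of permutations in $\mathfrak{S}_n$ of cycle type $\lambda$. Then $$\sum_{\pi\in\mathfrak{S}_n(\lambda)}t^{\mathrm{exc}(\pi)}=\sum_{i=0}^{\lfloor (n-k)/2\rfloor}\gamma_i\,t^i(1+t)^{n-k-2i},$$ where $\gamma_i=2^{-n+k+2i}\,\left|\{\pi\in\mathfrak{S}_n(\lambda):\mathrm{cval}(\pi)=i\}\right|$.
   Context: $[n]=\{1,\dots,n\}$ and $\mathfrak{S}_n$ is the symmetric group on $[n]$. For $\pi\in\mathfrak{S}_n$, an excedance of $\pi$ is an $i\in[n]$ with $i<\pi(i)$, and $\mathrm{exc}(\pi)$ is the number of excedances. A cyclic valley of $\pi$ is an $i\in[n]$ with $\pi^{-1}(i)>i<\pi(i)$, and $\mathrm{cval}(\pi)$ is the number of cyclic valleys. *)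

theory Defs
  imports
    Complex_Main
    "HOL-Library.Multiset"
    "HOL-Combinatorics.Orbits"
    "HOL-Computational_Algebra.Polynomial"
begin

text \<open>
  A permutation of \<open>[n]\<close> is a function \<open>\<pi>\<close> with \<open>\<pi> permutes {1..n}\<close>, that is, a bijection of
  \<open>nat\<close> that fixes every point outside \<open>{1..n}\<close>; \<open>inv \<pi>\<close> is then the inverse permutation.
\<close>

definition exc :: "nat \<Rightarrow> (nat \<Rightarrow> nat) \<Rightarrow> nat" where
  "exc n \<pi> = card {i \<in> {1..n}. i < \<pi> i}"

definition cval :: "nat \<Rightarrow> (nat \<Rightarrow> nat) \<Rightarrow> nat" where
  "cval n \<pi> = card {i \<in> {1..n}. inv \<pi> i > i \<and> i < \<pi> i}"

text \<open>
  Partitions are multisets of positive parts. The image \<open>orbit \<pi> ` {1..n}\<close> is the set of cycles of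
  \<open>\<pi>\<close>, so each cycle contributes its length once; fixed points are cycles of length 1.
\<close>

definition partition_of :: "nat \<Rightarrow> nat multiset \<Rightarrow> bool" where
  "partition_of n L \<longleftrightarrow> (\<forall>p \<in># L. p > 0) \<and> sum_mset L = n"

definition cycle_type :: "nat \<Rightarrow> (nat \<Rightarrow> nat) \<Rightarrow> nat multiset" where
  "cycle_type n \<pi> = image_mset card (mset_set (orbit \<pi> ` {1..n}))"

definition perms_of_type :: "nat \<Rightarrow> nat multiset \<Rightarrow> (nat \<Rightarrow> nat) set" where
  "perms_of_type n L = {\<pi>. \<pi> permutes {1..n} \<and> cycle_type n \<pi> = L}"

end

theory Submission
  imports Defs
begin

text \<open>
  This is valley hopping (the Foata--Strehl action) performed on the cycles of \<open>\<pi>\<close>. If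
  \<open>\<pi>\<^sup>-\<^sup>1(x) < x < \<pi>(x)\<close>, follow the cycle forward from \<open>x\<close> as long as it stays above \<open>x\<close> and move \<open>x\<close>
  to the end of that run. This keeps the orbits, turns \<open>x\<close> from a cyclic double ascent into a
  cyclic double descent, does not change the type of any other element, and is injective. Together
  with the symmetry \<open>\<pi> \<mapsto> \<pi>\<^sup>-\<^sup>1\<close>, which exchanges double ascents and double descents, this shows that
  the number of permutations of given cycle type with prescribed sets of valleys, peaks, double
  ascents and double descents depends, beyond the valleys and peaks, only on the union \<open>R\<close> of the
  last two. Since excedances are the valleys and double ascents, such a family, with \<open>v\<close> valleys,
  contributes a multiple of \<open>t\<^sup>v (1 + t)\<^bsup>|R|\<^esup>\<close>, where \<open>|R| = n - k - 2 v\<close>.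
\<close>

section \<open>Types of elements on a cycle, and the hop of a double ascent\<close>

definition cyc_valleys :: "('a::linorder \<Rightarrow> 'a) \<Rightarrow> 'a set" where
  "cyc_valleys \<pi> = {i. i < inv \<pi> i \<and> i < \<pi> i}"

definition cyc_peaks :: "('a::linorder \<Rightarrow> 'a) \<Rightarrow> 'a set" where
  "cyc_peaks \<pi> = {i. inv \<pi> i < i \<and> \<pi> i < i}"

definition cyc_ascents :: "('a::linorder \<Rightarrow> 'a) \<Rightarrow> 'a set" where
  "cyc_ascents \<pi> = {i. inv \<pi> i < i \<and> i < \<pi> i}"

definition cyc_descents :: "('a::linorder \<Rightarrow> 'a) \<Rightarrow> 'a set" where
  "cyc_descents \<pi> = {i. i < inv \<pi> i \<and> \<pi> i < i}"

text \<open>The last element of the run \<open>x, \<pi> x, \<pi> (\<pi> x), \<dots>\<close> before it first drops below \<open>x\<close>.\<close>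

definition hop_end :: "('a::linorder \<Rightarrow> 'a) \<Rightarrow> 'a \<Rightarrow> 'a" where
  "hop_end \<pi> x = (\<pi> ^^ (LEAST m. (\<pi> ^^ Suc m) x < x)) x"

text \<open>The cycle \<open>(\<dots> a x y \<dots> z b \<dots>)\<close> becomes \<open>(\<dots> a y \<dots> z x b \<dots>)\<close>, where \<open>z = hop_end \<pi> x\<close>.\<close>

definition hop :: "('a::linorder \<Rightarrow> 'a) \<Rightarrow> 'a \<Rightarrow> 'a \<Rightarrow> 'a" where
  "hop \<pi> x = \<pi> \<circ> transpose (inv \<pi> x) x \<circ> transpose x (hop_end \<pi> x)"

text \<open>The cycle of \<open>x\<close> reaches \<open>inv \<pi> x\<close>, which is below
  \<open>x\<close>, so the \<open>LEAST\<close> in \<open>hop_end\<close> is attained. The run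
  cannot meet \<open>x\<close> again before dropping: one step earlier it would be at
  \<open>inv \<pi> x\<close>, already below \<open>x\<close>.\<close>

lemma hop_path:
  assumes "permutation \<pi>" "inv \<pi> x < x" "x < \<pi> x"
  obtains m where "m > 0" "(\<pi> ^^ m) x = hop_end \<pi> x" "\<pi> (hop_end \<pi> x) < x"
    "\<And>j. 0 < j \<Longrightarrow> j \<le> m \<Longrightarrow> x < (\<pi> ^^ j) x"
proof -
  have bij: "bij \<pi>" using assms(1) by (rule permutation_bijective)
  define m where "m = (LEAST m. (\<pi> ^^ Suc m) x < x)"
  have "inv \<pi> x \<in> orbit \<pi> x"
    using assms(1) by (metis orbit.base orbit_inv_eq)
  then obtain k where "k > 0" "(\<pi> ^^ k) x = inv \<pi> x"
    unfolding orbit_altdef by auto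
  then have "(\<pi> ^^ Suc (k - 1)) x < x" using assms(2) by simp
  then have less: "(\<pi> ^^ Suc m) x < x" unfolding m_def by (rule LeastI)
  have ge: "x \<le> (\<pi> ^^ Suc i) x" if "i < m" for i
    using not_less_Least[of i "\<lambda>m. (\<pi> ^^ Suc m) x < x"] that unfolding m_def by simp
  have ne: "(\<pi> ^^ Suc i) x \<noteq> x" if "i < m" for i
  proof
    assume "(\<pi> ^^ Suc i) x = x"
    then have eq: "(\<pi> ^^ i) x = inv \<pi> x" using bij by (simp add: bij_inv_eq_iff)
    then obtain i' where "i = Suc i'" using assms(2) by (cases i) auto
    then show False using ge[of i'] eq assms(2) that by simp
  qed
  show ?thesis
  proof (rule that[of m])
    show "m > 0" using less assms(3) by (cases m) auto
    show "(\<pi> ^^ m) x = hop_end \<pi> x" by (simp add: hop_end_def m_def)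
    then show "\<pi> (hop_end \<pi> x) < x" using less by simp
    show "x < (\<pi> ^^ j) x" if "0 < j" "j \<le> m" for j
      using ge[of "j - 1"] ne[of "j - 1"] that by (cases j) auto
  qed
qed

lemma hop_end_greater:
  assumes "permutation \<pi>" "inv \<pi> x < x" "x < \<pi> x"
  shows "x < hop_end \<pi> x" "\<pi> (hop_end \<pi> x) < x"
proof -
  obtain m where "m > 0" "(\<pi> ^^ m) x = hop_end \<pi> x" "\<pi> (hop_end \<pi> x) < x"
    "\<And>j. 0 < j \<Longrightarrow> j \<le> m \<Longrightarrow> x < (\<pi> ^^ j) x"
    using hop_path[OF assms] by metis
  then show "x < hop_end \<pi> x" "\<pi> (hop_end \<pi> x) < x" by (metis order_refl)+
qed

lemma hop_apply:
  assumes "permutation \<pi>" "inv \<pi> x < x" "x < \<pi> x"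
  shows "hop \<pi> x (inv \<pi> x) = \<pi> x" "hop \<pi> x x = \<pi> (hop_end \<pi> x)"
    "hop \<pi> x (hop_end \<pi> x) = x"
    "\<And>i. i \<noteq> inv \<pi> x \<Longrightarrow> i \<noteq> x \<Longrightarrow> i \<noteq> hop_end \<pi> x \<Longrightarrow> hop \<pi> x i = \<pi> i"
  using hop_end_greater[OF assms] assms(2) permutation_bijective[OF assms(1)]
  by (auto simp: hop_def transpose_def bij_is_surj surj_f_inv_f)

lemma permutes_hop:
  assumes "\<pi> permutes S" "finite S" "inv \<pi> x < x" "x < \<pi> x"
  shows "hop \<pi> x permutes S"
proof -
  have perm: "permutation \<pi>" using assms(1,2) permutation_permutes by blast
  have x: "x \<in> S" using assms(1,4) by (metis less_irrefl permutes_not_in)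
  moreover have "inv \<pi> x \<in> S" using assms(1) x by (simp add: permutes_in_image permutes_inv)
  moreover have "hop_end \<pi> x \<in> S"
    using hop_end_greater[OF perm assms(3,4)] assms(1)
    by (metis less_asym permutes_not_in)
  ultimately show ?thesis unfolding hop_def
    by (intro permutes_compose permutes_swap_id assms(1))
qed

lemma inv_hop_apply:
  assumes "\<pi> permutes S" "finite S" "inv \<pi> x < x" "x < \<pi> x"
  shows "inv (hop \<pi> x) (\<pi> x) = inv \<pi> x" "inv (hop \<pi> x) (\<pi> (hop_end \<pi> x)) = x"
    "inv (hop \<pi> x) x = hop_end \<pi> x"
    "\<And>i. i \<noteq> x \<Longrightarrow> i \<noteq> \<pi> x \<Longrightarrow> i \<noteq> \<pi> (hop_end \<pi> x) \<Longrightarrow> inv (hop \<pi> x) i = inv \<pi> i"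
proof -
  have perm: "permutation \<pi>" using assms(1,2) permutation_permutes by blast
  note [simp] = hop_apply[OF perm assms(3,4)]
  have inj: "inj (hop \<pi> x)" using permutes_hop[OF assms] by (rule permutes_inj)
  have bij: "bij \<pi>" using perm by (rule permutation_bijective)
  show "inv (hop \<pi> x) (\<pi> x) = inv \<pi> x" "inv (hop \<pi> x) (\<pi> (hop_end \<pi> x)) = x"
    "inv (hop \<pi> x) x = hop_end \<pi> x"
    by (rule inv_f_eq[OF inj], simp)+
  show "inv (hop \<pi> x) i = inv \<pi> i" if "i \<noteq> x" "i \<noteq> \<pi> x" "i \<noteq> \<pi> (hop_end \<pi> x)" for i
  proof (rule inv_f_eq[OF inj])
    have "\<pi> (inv \<pi> i) = i" using bij by (simp add: bij_is_surj surj_f_inv_f)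
    moreover have "\<pi> (inv \<pi> x) = x" using bij by (simp add: bij_is_surj surj_f_inv_f)
    ultimately show "hop \<pi> x (inv \<pi> i) = i"
      by (subst hop_apply(4)[OF perm assms(3,4)]) (use that in metis)+
  qed
qed

text \<open>The new cycle skips \<open>x\<close> after \<open>inv \<pi> x\<close> and then follows
  the old run. Hence the same exponents serve for \<open>\<pi>\<close> started at \<open>x\<close>
  and for \<open>hop \<pi> x\<close> started at \<open>inv \<pi> x\<close>.\<close>

lemma funpow_hop:
  assumes "permutation \<pi>" "inv \<pi> x < x" "x < \<pi> x"
  obtains m where "m > 0" "(hop \<pi> x ^^ m) (inv \<pi> x) = hop_end \<pi> x"
    "\<And>j. 0 < j \<Longrightarrow> j \<le> m \<Longrightarrow> x < (hop \<pi> x ^^ j) (inv \<pi> x)"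
proof -
  obtain m where m: "m > 0" "(\<pi> ^^ m) x = hop_end \<pi> x" "\<pi> (hop_end \<pi> x) < x"
    "\<And>j. 0 < j \<Longrightarrow> j \<le> m \<Longrightarrow> x < (\<pi> ^^ j) x"
    using hop_path[OF assms] by metis
  have eq: "(hop \<pi> x ^^ Suc j) (inv \<pi> x) = (\<pi> ^^ Suc j) x" if "Suc j \<le> m" for j
    using that
  proof (induction j)
    case 0
    then show ?case by (simp add: hop_apply[OF assms])
  next
    case (Suc j)
    let ?y = "(\<pi> ^^ Suc j) x"
    have "x < ?y" "x < \<pi> ?y" using m(4)[of "Suc j"] m(4)[of "Suc (Suc j)"] Suc.prems by auto
    \<comment> \<open>Both \<open>?y\<close> and its image lie above \<open>x\<close>, so
      \<open>?y\<close> is none of the three points where the hop differs from \<open>\<pi>\<close>;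
      the image of \<open>hop_end \<pi> x\<close> is below \<open>x\<close>.\<close>
    then have "hop \<pi> x ?y = \<pi> ?y" using m(3) assms(2) by (intro hop_apply(4)[OF assms]) auto
    then show ?case using Suc by simp
  qed
  show ?thesis
  proof (rule that[of m])
    show "(hop \<pi> x ^^ m) (inv \<pi> x) = hop_end \<pi> x" using eq[of "m - 1"] m(1,2) by (cases m) auto
    show "x < (hop \<pi> x ^^ j) (inv \<pi> x)" if "0 < j" "j \<le> m" for j
      using eq[of "j - 1"] m(4)[of j] that by (cases j) auto
  qed (fact m)
qed

section \<open>Hops preserve the orbits\<close>

lemma orbit_mono:
  assumes "\<And>i. f i \<in> orbit g i"
  shows "orbit f x \<subseteq> orbit g x"
proof
  fix y assume "y \<in> orbit f x"
  then show "y \<in> orbit g x"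
    by induction (use assms orbit_trans in metis)+
qed

text \<open>By \<open>orbit_mono\<close> it is enough that each map sends every point into its orbit
  under the other. Only \<open>inv \<pi> x\<close>, \<open>x\<close> and
  \<open>hop_end \<pi> x\<close> need a check, and these three lie on one cycle of either
  map.\<close>

lemma orbit_hop:
  assumes "\<pi> permutes S" "finite S" "inv \<pi> x < x" "x < \<pi> x"
  shows "orbit (hop \<pi> x) = orbit \<pi>"
proof (intro ext equalityI orbit_mono)
  let ?a = "inv \<pi> x" and ?z = "hop_end \<pi> x" and ?h = "hop \<pi> x"
  have perm: "permutation \<pi>" using assms(1,2) permutation_permutes by blast
  have permh: "permutation ?h" using permutes_hop[OF assms] assms(2) permutation_permutes by blast
  have \<pi>a: "\<pi> ?a = x" using permutes_inverses[OF assms(1)] by simp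
  note app = hop_apply[OF perm assms(3,4)]
  have sym: "p \<in> orbit f q \<Longrightarrow> q \<in> orbit f p" if "permutation f" for f :: "'a \<Rightarrow> 'a" and p q
    using that by (meson orbit_swap permutation_self_in_orbit)
  note tr = orbit_trans
  obtain m where "m > 0" "(\<pi> ^^ m) x = ?z" using hop_path[OF perm assms(3,4)] by metis
  then have zx: "?z \<in> orbit \<pi> x" unfolding orbit_altdef by force
  obtain m where "m > 0" "(?h ^^ m) ?a = ?z" using funpow_hop[OF perm assms(3,4)] by metis
  then have za: "?z \<in> orbit ?h ?a" unfolding orbit_altdef by force
  have xz: "x \<in> orbit ?h ?z" using orbit.base[of ?h ?z] app by simp
  show "?h i \<in> orbit \<pi> i" for i
  proof -
    have "\<pi> x \<in> orbit \<pi> ?a" using orbit.step[OF orbit.base[of \<pi> ?a]] \<pi>a by simp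
    moreover have "\<pi> ?z \<in> orbit \<pi> x" using zx by (rule orbit.step)
    moreover have "x \<in> orbit \<pi> ?z" using sym[OF perm zx] .
    ultimately show ?thesis using app orbit.base[of \<pi> i] by metis
  qed
  show "\<pi> i \<in> orbit ?h i" for i
  proof -
    have xa: "x \<in> orbit ?h ?a" using tr[OF xz za] .
    moreover have "\<pi> x \<in> orbit ?h x"
      using tr[OF orbit.base[of ?h ?a] sym[OF permh xa]] app by simp
    moreover have "\<pi> ?z \<in> orbit ?h ?z"
      using tr[OF orbit.base[of ?h x] xz] app by simp
    ultimately show ?thesis using app \<pi>a orbit.base[of ?h i] by metis
  qed
qed

section \<open>Injectivity of hops\<close>

text \<open>Injectivity of \<open>f ^^ k\<close> places \<open>a\<close> on the path from
  \<open>b\<close> to \<open>x\<close>, namely \<open>l - k\<close> steps after \<open>b\<close>. If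
  \<open>k < l\<close>, this is an inner point of the path, hence above \<open>x\<close>, against
  \<open>a < x\<close>.\<close>

lemma first_return_le:
  fixes a b x :: "'a::linorder"
  assumes "inj f" "(f ^^ k) a = x" "(f ^^ l) b = x" "k \<le> l"
    "b < x" "a < x" "\<And>i. 0 < i \<Longrightarrow> i < l \<Longrightarrow> x < (f ^^ i) b" "k > 0"
  shows "a = b"
proof -
  have "(f ^^ k) ((f ^^ (l - k)) b) = (f ^^ k) a"
    using assms(2-4) by (metis comp_apply funpow_add le_add_diff_inverse)
  then have eq: "(f ^^ (l - k)) b = a" using inj_fn[OF assms(1), of k] by (simp add: inj_eq)
  show ?thesis
  proof (cases "k = l")
    case False
    then have "x < (f ^^ (l - k)) b" using assms(4,8) by (intro assms(7)) auto
    then show ?thesis using eq assms(6) by (auto dest: less_asym)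
  qed (use eq in simp)
qed

text \<open>
  In \<open>hop \<pi> x\<close> the predecessor of \<open>x\<close> is \<open>hop_end \<pi> x\<close>, and \<open>inv \<pi> x\<close> is the first element below \<open>x\<close>
  met when going backwards from \<open>x\<close>; so both can be read off.
\<close>

lemma hop_inject:
  assumes p: "\<pi> permutes S" "inv \<pi> x < x" "x < \<pi> x"
    and q: "\<sigma> permutes S" "inv \<sigma> x < x" "x < \<sigma> x"
    and "finite S" and eq: "hop \<pi> x = hop \<sigma> x"
  shows "\<pi> = \<sigma>"
proof -
  have path: "\<exists>l>0. (hop \<rho> x ^^ l) (inv \<rho> x) = x \<and> (\<forall>i. 0 < i \<longrightarrow> i < l \<longrightarrow> x < (hop \<rho> x ^^ i) (inv \<rho> x))"
    if \<rho>: "\<rho> permutes S" "inv \<rho> x < x" "x < \<rho> x" for \<rho>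
  proof -
    have perm: "permutation \<rho>" using that(1) \<open>finite S\<close> permutation_permutes by blast
    obtain m where "m > 0" "(hop \<rho> x ^^ m) (inv \<rho> x) = hop_end \<rho> x"
      "\<And>j. 0 < j \<Longrightarrow> j \<le> m \<Longrightarrow> x < (hop \<rho> x ^^ j) (inv \<rho> x)"
      using funpow_hop[OF perm \<rho>(2,3)] by metis
    \<comment> \<open>One step after \<open>hop_end \<rho> x\<close> the new cycle is at
      \<open>x\<close>.\<close>
    then show ?thesis using hop_apply(3)[OF perm \<rho>(2,3)] by (intro exI[of _ "Suc m"]) auto
  qed
  have inj: "inj (hop \<pi> x)" using permutes_hop[OF p(1) \<open>finite S\<close> p(2,3)] by (rule permutes_inj)
  have inveq: "inv \<pi> x = inv \<sigma> x"
  proof -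
    obtain k where k: "k > 0" "(hop \<pi> x ^^ k) (inv \<pi> x) = x"
      "\<And>i. 0 < i \<Longrightarrow> i < k \<Longrightarrow> x < (hop \<pi> x ^^ i) (inv \<pi> x)" using path[OF p] by blast
    obtain l where l: "l > 0" "(hop \<pi> x ^^ l) (inv \<sigma> x) = x"
      "\<And>i. 0 < i \<Longrightarrow> i < l \<Longrightarrow> x < (hop \<pi> x ^^ i) (inv \<sigma> x)" using path[OF q] eq by metis
    show ?thesis
      using first_return_le[OF inj k(2) l(2) _ q(2) p(2) l(3) k(1)]
        first_return_le[OF inj l(2) k(2) _ p(2) q(2) k(3) l(1)] by (cases "k \<le> l") auto
  qed
  have endeq: "hop_end \<pi> x = hop_end \<sigma> x"
    using inv_hop_apply(3)[OF p(1) \<open>finite S\<close> p(2,3)] inv_hop_apply(3)[OF q(1) \<open>finite S\<close> q(2,3)] eq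
    by simp
  \<comment> \<open>Transpositions are involutions, so applying the two in the opposite order
    recovers the permutation from its hop.\<close>
  have undo: "hop \<rho> x \<circ> transpose x (hop_end \<rho> x) \<circ> transpose (inv \<rho> x) x = \<rho>" for \<rho>
    by (rule ext) (simp add: hop_def)
  have "\<pi> = hop \<pi> x \<circ> transpose x (hop_end \<pi> x) \<circ> transpose (inv \<pi> x) x"
    by (rule undo[symmetric])
  also have "\<dots> = hop \<sigma> x \<circ> transpose x (hop_end \<sigma> x) \<circ> transpose (inv \<sigma> x) x"
    by (simp only: eq inveq endeq)
  also have "\<dots> = \<sigma>" by (rule undo)
  finally show ?thesis .
qed

section \<open>Effect of a hop on the types of elements\<close>

text \<open>Where a neighbour changes, the old and the new one lie on the same side. The successor
  of \<open>inv \<pi> x\<close> changes from \<open>x\<close> to \<open>\<pi> x\<close>, both above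
  it, and that of \<open>hop_end \<pi> x\<close> from a value below \<open>x\<close> to
  \<open>x\<close>, both below it. Predecessors behave likewise at \<open>\<pi> x\<close> and
  \<open>\<pi> (hop_end \<pi> x)\<close>.\<close>

lemma sgn_hop:
  assumes "\<pi> permutes S" "finite S" "inv \<pi> x < x" "x < \<pi> x" "i \<noteq> x"
  shows "i < hop \<pi> x i \<longleftrightarrow> i < \<pi> i" "hop \<pi> x i < i \<longleftrightarrow> \<pi> i < i"
    "i < inv (hop \<pi> x) i \<longleftrightarrow> i < inv \<pi> i" "inv (hop \<pi> x) i < i \<longleftrightarrow> inv \<pi> i < i"
proof -
  have perm: "permutation \<pi>" using assms(1,2) permutation_permutes by blast
  note app = hop_apply[OF perm assms(3,4)] and iapp = inv_hop_apply[OF assms(1-4)]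
  note inv = permutes_inverses[OF assms(1)]
  note z = hop_end_greater[OF perm assms(3,4)]
  have same_side: "(i < u \<longleftrightarrow> i < v) \<and> (u < i \<longleftrightarrow> v < i)"
    if "i < u \<and> i < v \<or> u < i \<and> v < i \<or> u = v" for u v :: 'a
    using that by (metis less_asym)
  have "i < hop \<pi> x i \<and> i < \<pi> i \<or> hop \<pi> x i < i \<and> \<pi> i < i \<or> hop \<pi> x i = \<pi> i"
  proof -
    consider "i = inv \<pi> x" | "i = hop_end \<pi> x" | "i \<noteq> inv \<pi> x" "i \<noteq> hop_end \<pi> x" by blast
    then show ?thesis
    proof cases
      case 1
      then have "i < hop \<pi> x i" "i < \<pi> i" using app(1) inv(1)[of x] assms(3,4) by simp_all
      then show ?thesis by blast
    next
      case 2
      then have "hop \<pi> x i < i" "\<pi> i < i" using app(3) z by simp_all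
      then show ?thesis by blast
    next
      case 3
      then show ?thesis using app(4)[of i] assms(5) by blast
    qed
  qed
  from same_side[OF this]
  show "i < hop \<pi> x i \<longleftrightarrow> i < \<pi> i" "hop \<pi> x i < i \<longleftrightarrow> \<pi> i < i" by blast+
  have "i < inv (hop \<pi> x) i \<and> i < inv \<pi> i \<or> inv (hop \<pi> x) i < i \<and> inv \<pi> i < i
    \<or> inv (hop \<pi> x) i = inv \<pi> i"
  proof -
    consider "i = \<pi> x" | "i = \<pi> (hop_end \<pi> x)" | "i \<noteq> \<pi> x" "i \<noteq> \<pi> (hop_end \<pi> x)" by blast
    then show ?thesis
    proof cases
      case 1
      then have "inv (hop \<pi> x) i < i" "inv \<pi> i < i"
        using iapp(1) inv(2)[of x] assms(3,4) by simp_all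
      then show ?thesis by blast
    next
      case 2
      then have "i < inv (hop \<pi> x) i" "i < inv \<pi> i"
        using iapp(2) inv(2)[of "hop_end \<pi> x"] z by simp_all
      then show ?thesis by blast
    next
      case 3
      then show ?thesis using iapp(4)[of i] assms(5) by blast
    qed
  qed
  from same_side[OF this]
  show "i < inv (hop \<pi> x) i \<longleftrightarrow> i < inv \<pi> i" "inv (hop \<pi> x) i < i \<longleftrightarrow> inv \<pi> i < i" by blast+
qed

lemma cyc_sets_hop:
  assumes "\<pi> permutes S" "finite S" "inv \<pi> x < x" "x < \<pi> x"
  shows "cyc_valleys (hop \<pi> x) = cyc_valleys \<pi>" "cyc_peaks (hop \<pi> x) = cyc_peaks \<pi>"
    "cyc_ascents (hop \<pi> x) = cyc_ascents \<pi> - {x}"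
    "cyc_descents (hop \<pi> x) = insert x (cyc_descents \<pi>)"
proof -
  have perm: "permutation \<pi>" using assms(1,2) permutation_permutes by blast
  have x: "hop \<pi> x x < x" "x < inv (hop \<pi> x) x"
    using hop_apply[OF perm assms(3,4)] inv_hop_apply[OF assms] hop_end_greater[OF perm assms(3,4)]
    by auto
  note sg = sgn_hop[OF assms]
  note defs = cyc_valleys_def cyc_peaks_def cyc_ascents_def cyc_descents_def
  show "cyc_valleys (hop \<pi> x) = cyc_valleys \<pi>" "cyc_peaks (hop \<pi> x) = cyc_peaks \<pi>"
    "cyc_ascents (hop \<pi> x) = cyc_ascents \<pi> - {x}"
    "cyc_descents (hop \<pi> x) = insert x (cyc_descents \<pi>)"
    unfolding defs set_eq_iff mem_Collect_eq Diff_iff insert_iff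
    using sg x assms(3,4) by (metis less_asym empty_iff)+
qed

section \<open>Permutations of a cycle type with all four sets prescribed\<close>

definition perms_with ::
  "nat \<Rightarrow> nat multiset \<Rightarrow> nat set \<Rightarrow> nat set \<Rightarrow> nat set \<Rightarrow> nat set \<Rightarrow> (nat \<Rightarrow> nat) set" where
  "perms_with n L V P A D = {\<pi> \<in> perms_of_type n L.
     cyc_valleys \<pi> = V \<and> cyc_peaks \<pi> = P \<and> cyc_ascents \<pi> = A \<and> cyc_descents \<pi> = D}"

lemma finite_perms_of_type [simp]: "finite (perms_of_type n L)"
  unfolding perms_of_type_def by (rule finite_subset[OF _ finite_permutations[of "{1..n}"]]) auto

lemma finite_perms_with [simp]: "finite (perms_with n L V P A D)"
  unfolding perms_with_def by simp

lemma card_perms_with_hop: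
  assumes "x \<in> A"
  shows "card (perms_with n L V P A D) \<le> card (perms_with n L V P (A - {x}) (insert x D))"
proof (rule card_inj_on_le[where f = "\<lambda>\<pi>. hop \<pi> x"])
  have *: "\<pi> permutes {1..n}" "inv \<pi> x < x" "x < \<pi> x" "cycle_type n \<pi> = L"
    if "\<pi> \<in> perms_with n L V P A D" for \<pi>
    using that assms by (auto simp: perms_with_def perms_of_type_def cyc_ascents_def)
  show "inj_on (\<lambda>\<pi>. hop \<pi> x) (perms_with n L V P A D)"
    by (rule inj_onI) (meson * hop_inject finite_atLeastAtMost)
  show "(\<lambda>\<pi>. hop \<pi> x) ` perms_with n L V P A D \<subseteq> perms_with n L V P (A - {x}) (insert x D)"
  proof (rule image_subsetI)
    fix \<pi> assume \<pi>: "\<pi> \<in> perms_with n L V P A D"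
    note h = *(1)[OF \<pi>] finite_atLeastAtMost *(2,3)[OF \<pi>]
    show "hop \<pi> x \<in> perms_with n L V P (A - {x}) (insert x D)"
      using permutes_hop[OF h] orbit_hop[OF h] cyc_sets_hop[OF h] \<pi>
      by (auto simp: perms_with_def perms_of_type_def cycle_type_def)
  qed
qed simp

lemma inv_perms_with: "inv ` perms_with n L V P A D \<subseteq> perms_with n L V P D A"
proof (rule image_subsetI)
  fix \<pi> assume \<pi>: "\<pi> \<in> perms_with n L V P A D"
  then have p: "\<pi> permutes {1..n}" by (simp add: perms_with_def perms_of_type_def)
  then have "permutation \<pi>" using permutation_permutes by blast
  then have "orbit (inv \<pi>) = orbit \<pi>" by (simp add: orbit_inv_eq fun_eq_iff)
  then show "inv \<pi> \<in> perms_with n L V P D A"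
    using \<pi> permutes_inv[OF p] permutes_inv_inv[OF p]
    by (auto simp: perms_with_def perms_of_type_def cycle_type_def cyc_valleys_def cyc_peaks_def
        cyc_ascents_def cyc_descents_def)
qed

lemma card_perms_with_swap: "card (perms_with n L V P A D) = card (perms_with n L V P D A)"
proof -
  have "card (perms_with n L V P A D) \<le> card (perms_with n L V P D A)" for A D
  proof (rule card_inj_on_le[OF _ inv_perms_with finite_perms_with])
    show "inj_on inv (perms_with n L V P A D)"
      by (rule inj_onI) (metis (no_types, lifting) mem_Collect_eq perms_of_type_def perms_with_def permutes_inv_inv)
  qed
  then show ?thesis by (meson le_antisym)
qed

text \<open>A hop gives one inequality. For the other, inversion turns the double descent
  \<open>x\<close> into a double ascent, a hop moves it back, and a second inversion restores the
  roles of the two sets.\<close>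

lemma card_perms_with_move:
  assumes "x \<in> A" "x \<notin> D"
  shows "card (perms_with n L V P A D) = card (perms_with n L V P (A - {x}) (insert x D))"
proof (rule le_antisym)
  have "card (perms_with n L V P (A - {x}) (insert x D))
      = card (perms_with n L V P (insert x D) (A - {x}))" by (rule card_perms_with_swap)
  also have "\<dots> \<le> card (perms_with n L V P (insert x D - {x}) (insert x (A - {x})))"
    by (rule card_perms_with_hop) simp
  also have "\<dots> = card (perms_with n L V P A D)"
    using assms by (simp add: insert_absorb card_perms_with_swap[of n L V P D])
  finally show "card (perms_with n L V P (A - {x}) (insert x D)) \<le> card (perms_with n L V P A D)" .
qed (rule card_perms_with_hop[OF assms(1)])

text \<open>Moving the elements of \<open>A\<close> into \<open>D\<close> one at a time shows that
  the count depends on \<open>A\<close> and \<open>D\<close> only through their union.\<close>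

lemma card_perms_with_eq:
  assumes "finite A" "A \<inter> D = {}"
  shows "card (perms_with n L V P A D) = card (perms_with n L V P {} (A \<union> D))"
  using assms
proof (induction A arbitrary: D)
  case (insert x A)
  then show ?case using card_perms_with_move[of x "insert x A" D n L V P] by simp
qed simp

section \<open>Excedances, cyclic valleys and fixed points in terms of the four sets\<close>

lemma cyc_sets_subset:
  assumes "\<pi> permutes S"
  shows "cyc_valleys \<pi> \<subseteq> S" "cyc_peaks \<pi> \<subseteq> S" "cyc_ascents \<pi> \<subseteq> S" "cyc_descents \<pi> \<subseteq> S"
  by (rule subsetI, rule ccontr,
      simp add: permutes_not_in[OF assms] cyc_valleys_def cyc_peaks_def cyc_ascents_def cyc_descents_def)+

lemma excedances_eq:
  assumes "\<pi> permutes S"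
  shows "{i. i < \<pi> i} = cyc_valleys \<pi> \<union> cyc_ascents \<pi>"
    "{i. inv \<pi> i < i} = cyc_peaks \<pi> \<union> cyc_ascents \<pi>"
proof -
  have fixpoint: "inv \<pi> i = i \<longleftrightarrow> \<pi> i = i" for i using permutes_inv_eq[OF assms] by metis
  have "i < inv \<pi> i \<or> inv \<pi> i < i" if "i < \<pi> i" for i
    using that fixpoint by (metis linorder_neqE less_irrefl)
  then show "{i. i < \<pi> i} = cyc_valleys \<pi> \<union> cyc_ascents \<pi>"
    unfolding cyc_valleys_def cyc_ascents_def by blast
  have "i < \<pi> i \<or> \<pi> i < i" if "inv \<pi> i < i" for i
    using that fixpoint by (metis linorder_neqE less_irrefl)
  then show "{i. inv \<pi> i < i} = cyc_peaks \<pi> \<union> cyc_ascents \<pi>"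
    unfolding cyc_peaks_def cyc_ascents_def by blast
qed

text \<open>\<open>\<pi>\<close> maps the points with larger image bijectively onto the points with
  smaller preimage. The former are valleys and double ascents, the latter peaks and double ascents;
  cancel the double ascents.\<close>

lemma card_cyc_peaks:
  assumes "\<pi> permutes S" "finite S"
  shows "card (cyc_peaks \<pi>) = card (cyc_valleys \<pi>)"
proof -
  note fin = cyc_sets_subset[OF assms(1), THEN finite_subset, OF assms(2)]
  have "\<pi> ` {i. i < \<pi> i} = {i. inv \<pi> i < i}"
    using bij_image_Collect_eq[OF permutes_bij[OF assms(1)]] by (simp add: permutes_inverses[OF assms(1)])
  then have "card {i. i < \<pi> i} = card {i. inv \<pi> i < i}"
    using permutes_inj[OF assms(1)] by (metis card_image inj_on_subset subset_UNIV)
  moreover have "cyc_valleys \<pi> \<inter> cyc_ascents \<pi> = {}" "cyc_peaks \<pi> \<inter> cyc_ascents \<pi> = {}"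
    by (auto simp: cyc_valleys_def cyc_ascents_def cyc_peaks_def)
  ultimately show ?thesis using fin by (simp add: excedances_eq[OF assms(1)] card_Un_disjoint)
qed

lemma exc_eq:
  assumes "\<pi> permutes {1..n}"
  shows "exc n \<pi> = card (cyc_valleys \<pi>) + card (cyc_ascents \<pi>)"
proof -
  note sub = cyc_sets_subset[OF assms]
  note fin = sub[THEN finite_subset, OF finite_atLeastAtMost]
  have "{i \<in> {1..n}. i < \<pi> i} = cyc_valleys \<pi> \<union> cyc_ascents \<pi>"
    using excedances_eq(1)[OF assms] sub by blast
  moreover have "cyc_valleys \<pi> \<inter> cyc_ascents \<pi> = {}"
    by (auto simp: cyc_valleys_def cyc_ascents_def)
  ultimately show ?thesis using fin by (simp add: exc_def card_Un_disjoint)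
qed

lemma cval_eq:
  assumes "\<pi> permutes {1..n}"
  shows "cval n \<pi> = card (cyc_valleys \<pi>)"
proof -
  have "{i \<in> {1..n}. inv \<pi> i > i \<and> i < \<pi> i} = cyc_valleys \<pi>"
    using cyc_sets_subset(1)[OF assms] by (auto simp: cyc_valleys_def)
  then show ?thesis by (simp add: cval_def)
qed

lemma count_cycle_type_one:
  assumes "\<pi> permutes {1..n}"
  shows "count (cycle_type n \<pi>) 1 = card {i \<in> {1..n}. \<pi> i = i}"
proof -
  have perm: "permutation \<pi>" using assms permutation_permutes by blast
  let ?O = "orbit \<pi> ` {1..n}"
  have "count (cycle_type n \<pi>) 1 = (\<Sum>C \<in> {C \<in> ?O. card C = 1}. count (mset_set ?O) C)"
    unfolding cycle_type_def count_image_mset by (rule sum.cong) auto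
  also have "\<dots> = (\<Sum>C \<in> {C \<in> ?O. card C = 1}. 1)"
    by (rule sum.cong[OF refl]) (simp add: count_mset_set)
  also have "\<dots> = card {C \<in> ?O. card C = 1}" by simp
  also have "{C \<in> orbit \<pi> ` {1..n}. card C = 1} = (\<lambda>i. {i}) ` {i \<in> {1..n}. \<pi> i = i}"
  proof -
    have iff: "card (orbit \<pi> i) = 1 \<longleftrightarrow> \<pi> i = i" for i
      using permutation_self_in_orbit[OF perm, of i]
      by (metis card_1_singletonE is_singletonI is_singleton_altdef orbit_eq_singleton_iff singletonD)
    show ?thesis
    proof (intro equalityI subsetI)
      fix C assume "C \<in> {C \<in> ?O. card C = 1}"
      then obtain i where "i \<in> {1..n}" "C = orbit \<pi> i" "\<pi> i = i" using iff by blast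
      then show "C \<in> (\<lambda>i. {i}) ` {i \<in> {1..n}. \<pi> i = i}"
        by (metis (mono_tags, lifting) imageI mem_Collect_eq orbit_eq_singleton_iff)
    next
      fix C assume "C \<in> (\<lambda>i. {i}) ` {i \<in> {1..n}. \<pi> i = i}"
      then obtain i where i: "i \<in> {1..n}" "C = {i}" "\<pi> i = i" by blast
      then have "C = orbit \<pi> i" using orbit_eq_singleton_iff[of \<pi> i] by simp
      then show "C \<in> {C \<in> ?O. card C = 1}" using i iff[of i] by blast
    qed
  qed
  also have "card \<dots> = card {i \<in> {1..n}. \<pi> i = i}" by (simp add: card_image)
  finally show ?thesis .
qed

text \<open>The four types and the fixed points partition \<open>{1..n}\<close>, and there are as
  many peaks as valleys.\<close>

lemma card_cyc_sets:
  assumes "\<pi> permutes {1..n}"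
  shows "2 * card (cyc_valleys \<pi>) + card (cyc_ascents \<pi> \<union> cyc_descents \<pi>)
    + count (cycle_type n \<pi>) 1 = n"
proof -
  note sub = cyc_sets_subset[OF assms]
  note fin = sub[THEN finite_subset, OF finite_atLeastAtMost]
  let ?F = "{i \<in> {1..n}. \<pi> i = i}" and ?R = "cyc_ascents \<pi> \<union> cyc_descents \<pi>"
  have "{1..n} = cyc_valleys \<pi> \<union> cyc_peaks \<pi> \<union> ?R \<union> ?F" (is "_ = ?U")
  proof
    show "{1..n} \<subseteq> ?U"
    proof
      fix i assume i: "i \<in> {1..n}"
      have "inv \<pi> i = i \<longleftrightarrow> \<pi> i = i" using permutes_inverses[OF assms] by metis
      then consider "\<pi> i = i" | "i < inv \<pi> i \<or> inv \<pi> i < i" "i < \<pi> i \<or> \<pi> i < i"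
        by (metis linorder_neqE)
      then show "i \<in> ?U"
        by cases (use i in \<open>auto simp: cyc_valleys_def cyc_peaks_def cyc_ascents_def cyc_descents_def\<close>)
    qed
  qed (use sub in auto)
  then have "n = card ?U" by (metis card_atLeastAtMost diff_Suc_1)
  also have "\<dots> = card (cyc_valleys \<pi>) + card (cyc_peaks \<pi>) + card ?R + card ?F"
    using fin by (subst card_Un_disjoint; (simp; fail)?;
      (auto simp: cyc_valleys_def cyc_peaks_def cyc_ascents_def cyc_descents_def; fail)?)+
  finally show ?thesis
    using card_cyc_peaks[OF assms] count_cycle_type_one[OF assms] by simp
qed

section \<open>Summation over classes of equal profile\<close>

lemma sum_power_card_Pow:
  fixes t :: "'a::comm_semiring_1"
  assumes "finite R"
  shows "(\<Sum>A\<in>Pow R. t ^ card A) = (1 + t) ^ card R"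
  using prod_add[OF assms, of "\<lambda>_. t" "\<lambda>_. 1"] by (simp add: add.commute)

text \<open>Merging double ascents with double descents makes this invariant under hops and
  inversion.\<close>

definition cyc_profile :: "(nat \<Rightarrow> nat) \<Rightarrow> nat set \<times> nat set \<times> nat set" where
  "cyc_profile \<pi> = (cyc_valleys \<pi>, cyc_peaks \<pi>, cyc_ascents \<pi> \<union> cyc_descents \<pi>)"

text \<open>Each subset \<open>A\<close> of \<open>R\<close> occurs as the set of double ascents
  equally often, the double descents then being \<open>R - A\<close>. The weight \<open>f\<close> is
  left general: powers of \<open>t\<close> give the generating function, the constant 1 the size of
  the class.\<close>

lemma sum_fibre:
  fixes f :: "nat set \<Rightarrow> 'a::comm_semiring_1"
  assumes "finite R"
  shows "(\<Sum>\<pi> \<in> {\<pi> \<in> perms_of_type n L. cyc_profile \<pi> = (V, P, R)}. f (cyc_ascents \<pi>))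
    = of_nat (card (perms_with n L V P {} R)) * (\<Sum>A\<in>Pow R. f A)"
proof -
  let ?T = "{\<pi> \<in> perms_of_type n L. cyc_profile \<pi> = (V, P, R)}"
  have "(\<Sum>\<pi>\<in>?T. f (cyc_ascents \<pi>))
      = (\<Sum>A\<in>Pow R. \<Sum>\<pi> \<in> {\<pi> \<in> ?T. cyc_ascents \<pi> = A}. f (cyc_ascents \<pi>))"
    by (rule sum.group[symmetric]) (use assms in \<open>auto simp: cyc_profile_def\<close>)
  also have "\<dots> = (\<Sum>A\<in>Pow R. of_nat (card (perms_with n L V P {} R)) * f A)"
  proof (rule sum.cong[OF refl])
    fix A assume A: "A \<in> Pow R"
    have "{\<pi> \<in> ?T. cyc_ascents \<pi> = A} = perms_with n L V P A (R - A)"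
      using A by (auto simp: perms_with_def cyc_profile_def cyc_ascents_def cyc_descents_def)
    moreover have "card (perms_with n L V P A (R - A)) = card (perms_with n L V P {} R)"
      using card_perms_with_eq[of A "R - A"] A assms by (simp add: finite_subset Un_absorb1)
    ultimately show "(\<Sum>\<pi> \<in> {\<pi> \<in> ?T. cyc_ascents \<pi> = A}. f (cyc_ascents \<pi>))
        = of_nat (card (perms_with n L V P {} R)) * f A"
      by (simp add: perms_with_def)
  qed
  finally show ?thesis by (simp add: sum_distrib_left)
qed

text \<open>Within a profile class each summand is replaced by the class average. That average
  depends on the permutation only through \<open>cval\<close>, because \<open>card R\<close> is
  \<open>n - count L 1 - 2 * cval n \<pi>\<close>.\<close>

lemma sum_power_exc:
  fixes t :: "rat poly"
  shows "(\<Sum>\<pi> \<in> perms_of_type n L. t ^ exc n \<pi>) =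
    (\<Sum>\<pi> \<in> perms_of_type n L. smult (1 / 2 ^ (n - count L 1 - 2 * cval n \<pi>))
       (t ^ cval n \<pi> * (1 + t) ^ (n - count L 1 - 2 * cval n \<pi>)))" (is "_ = sum ?g _")
proof -
  let ?X = "perms_of_type n L"
  have fibre: "(\<Sum>\<pi> \<in> {\<pi> \<in> ?X. cyc_profile \<pi> = y}. t ^ exc n \<pi>)
      = sum ?g {\<pi> \<in> ?X. cyc_profile \<pi> = y}" if y_in: "y \<in> cyc_profile ` ?X" for y
  proof -
    obtain V P R where y: "y = (V, P, R)" by (cases y)
    let ?T = "{\<pi> \<in> ?X. cyc_profile \<pi> = (V, P, R)}"
    let ?c = "card (perms_with n L V P {} R)"
    \<comment> \<open>A member of the class supplies the finiteness of \<open>R\<close> and its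
      cardinality.\<close>
    obtain \<sigma> where \<sigma>: "\<sigma> \<in> ?T" using y_in y by auto
    then have "finite R"
      using cyc_sets_subset[of \<sigma> "{1..n}"]
      by (auto simp: perms_of_type_def cyc_profile_def intro: finite_subset)
    have T: "exc n \<pi> = card V + card (cyc_ascents \<pi>)" "cval n \<pi> = card V" if "\<pi> \<in> ?T" for \<pi>
      using that exc_eq[of \<pi> n] cval_eq[of \<pi> n]
      by (auto simp: perms_of_type_def cyc_profile_def)
    have R: "n - count L 1 - 2 * card V = card R"
      using \<sigma> card_cyc_sets[of \<sigma> n] by (auto simp: perms_of_type_def cyc_profile_def)
    have card: "card ?T = ?c * 2 ^ card R"
      using sum_fibre[OF \<open>finite R\<close>, of "\<lambda>_. 1 :: nat" n L V P] \<open>finite R\<close>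
      by (simp add: card_Pow)
    have "(\<Sum>\<pi>\<in>?T. t ^ exc n \<pi>) = t ^ card V * (\<Sum>\<pi>\<in>?T. t ^ card (cyc_ascents \<pi>))"
      unfolding sum_distrib_left by (rule sum.cong) (simp_all add: T power_add)
    also have "\<dots> = of_nat ?c * (t ^ card V * (1 + t) ^ card R)"
      using sum_fibre[OF \<open>finite R\<close>, of "\<lambda>A. t ^ card A" n L V P] sum_power_card_Pow[OF \<open>finite R\<close>, of t]
      by (simp add: mult.left_commute)
    also have "\<dots> = (\<Sum>\<pi>\<in>?T. smult (1 / 2 ^ card R) (t ^ card V * (1 + t) ^ card R))"
      \<comment> \<open>The class has \<open>?c * 2 ^ card R\<close> members, so the factor
        \<open>1 / 2 ^ card R\<close> leaves \<open>?c\<close>.\<close>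
      by (simp add: card of_nat_poly)
    also have "\<dots> = sum ?g ?T" by (rule sum.cong[OF refl]) (simp only: T R)
    finally show ?thesis by (simp add: y)
  qed
  have "(\<Sum>\<pi>\<in>?X. t ^ exc n \<pi>)
      = (\<Sum>y \<in> cyc_profile ` ?X. \<Sum>\<pi> \<in> {\<pi> \<in> ?X. cyc_profile \<pi> = y}. t ^ exc n \<pi>)"
    by (rule sum.image_gen) simp
  also have "\<dots> = (\<Sum>y \<in> cyc_profile ` ?X. sum ?g {\<pi> \<in> ?X. cyc_profile \<pi> = y})"
    by (rule sum.cong[OF refl fibre])
  also have "\<dots> = sum ?g ?X"
    by (rule sum.image_gen[symmetric]) simp
  finally show ?thesis .
qed

theorem corollary7:
  fixes n k :: nat and L :: "nat multiset" and t :: "rat poly" and \<gamma> :: "nat \<Rightarrow> rat"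
  assumes "n > 0"
    and "partition_of n L"
    and "count L 1 = k"
    and t: "t = [:0, 1:]"
    and \<gamma>: "\<And>i. \<gamma> i = 2 powi (- int n + int k + 2 * int i) *
                of_nat (card {\<pi> \<in> perms_of_type n L. cval n \<pi> = i})"
  shows "(\<Sum>\<pi> \<in> perms_of_type n L. t ^ exc n \<pi>) =
         (\<Sum>i = 0..(n - k) div 2. smult (\<gamma> i) (t ^ i * (1 + t) ^ (n - k - 2 * i)))"
proof -
  let ?X = "perms_of_type n L"
  let ?q = "\<lambda>i. smult (1 / 2 ^ (n - k - 2 * i)) (t ^ i * (1 + t) ^ (n - k - 2 * i))"
  \<comment> \<open>This keeps \<open>cval\<close> in the range of the outer sum and makes the
    truncated subtractions exact.\<close>
  have le: "k + 2 * cval n \<pi> \<le> n" if "\<pi> \<in> ?X" for \<pi>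
    using that card_cyc_sets[of \<pi> n] cval_eq[of \<pi> n] assms(3) by (auto simp: perms_of_type_def)
  have "(\<Sum>\<pi>\<in>?X. t ^ exc n \<pi>) = (\<Sum>\<pi>\<in>?X. ?q (cval n \<pi>))"
    using sum_power_exc[of t n L] assms(3) by simp
  also have "\<dots> = (\<Sum>i = 0..(n - k) div 2. \<Sum>\<pi> \<in> {\<pi> \<in> ?X. cval n \<pi> = i}. ?q (cval n \<pi>))"
    by (rule sum.group[symmetric]) (use le in fastforce)+
  also have "\<dots> = (\<Sum>i = 0..(n - k) div 2. smult (\<gamma> i) (t ^ i * (1 + t) ^ (n - k - 2 * i)))"
  proof (rule sum.cong[OF refl])
    fix i assume i: "i \<in> {0..(n - k) div 2}"
    let ?Y = "{\<pi> \<in> ?X. cval n \<pi> = i}"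
    have sum: "(\<Sum>\<pi>\<in>?Y. ?q (cval n \<pi>)) = smult (of_nat (card ?Y)) (?q i)"
      by (simp add: of_nat_poly)
    show "(\<Sum>\<pi>\<in>?Y. ?q (cval n \<pi>)) = smult (\<gamma> i) (t ^ i * (1 + t) ^ (n - k - 2 * i))"
    \<comment> \<open>If no permutation has \<open>i\<close> cyclic valleys, both sides vanish.
      Otherwise such a permutation gives \<open>k + 2 * i \<le> n\<close>, so the integer exponent
      in \<open>\<gamma> i\<close> is minus the natural number \<open>n - k - 2 * i\<close>.\<close>
    proof (cases "?Y = {}")
      case True
      then have "card ?Y = 0" by simp
      moreover from this have "\<gamma> i = 0" by (simp only: \<gamma> of_nat_0 mult_zero_right)
      ultimately show ?thesis by (simp only: sum of_nat_0 smult_0_left)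
    next
      case False
      then have "k + 2 * i \<le> n" using le by blast
      then have expo: "- int n + int k + 2 * int i = - int (n - k - 2 * i)" by simp
      have "\<gamma> i = of_nat (card ?Y) * (1 / 2 ^ (n - k - 2 * i))"
        unfolding \<gamma> expo by (simp add: power_int_minus divide_inverse)
      then show ?thesis using sum by simp
    qed
  qed
  finally show ?thesis .
qed

end
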